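(* Let $d\ge1$ and $1\le r\le d$ be integers. There exist constants $C>0$ and $n_0$ (depending only on $d$ and $r$) such that for all integers $n\ge n_0$: (i) $\overleftarrow{m}_{mon}(\mathbb{T}_n^d,r)\le \frac{2}{r}\binom{d}{r-1}n^{r-1}+Cn^{r-2}$; (ii) $m(\mathbb{T}_n^d,r)\le \frac{1}{r}\binom{d}{r-1}n^{r-1}+Cn^{r-2}$.
   Context: The $d$-dimensional torus $\mathbb{T}_n^d$ is the graph with vertex set $[n]^d=\{1,\dots,n\}^d$, where two vertices are adjacent iff they differ in exactly one coordinate $j$ and in that coordinate $x_j-x'_j\equiv\pm1\pmod n$. A configuration assigns each vertex a state active (1) or inactive (0); its size is the number of active vertices. In $r$-bootstrap percolation ($r$-BP), in each round an inactive vertex with at least $r$ active neighbors becomes active and active vertices stay active forever. In reversible $r$-BP, in each round every vertex becomes active if it has at least $r$ active neighbors and inactive otherwise. A dynamo is an initial configuration $\omega^{(0)}$ such that from some time on all vertices are active forever; it is monotone if moreover no active vertex ever becomes inactive ($\omega^{(t+1)}\ge\omega^{(t)}$ for all $t$). $m(G,r)$ is the minimum size of a dynamo under $r$-BP on $G$; $\overleftarrow{m}_{mon}(G,r)$ is the minimum size of a monotone dynamo under reversible $r$-BP on $G$. *)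

theory Defs
  imports Complex_Main "HOL-Library.FuncSet" "HOL-Number_Theory.Cong"
begin

text \<open>A graph is given by a vertex set \<open>V\<close> and an adjacency relation \<open>adj\<close>.
  A configuration is identified with its set of active vertices, a subset of \<open>V\<close>.\<close>

definition active_nbrs :: "'a set \<Rightarrow> ('a \<Rightarrow> 'a \<Rightarrow> bool) \<Rightarrow> 'a set \<Rightarrow> 'a \<Rightarrow> 'a set" where
  "active_nbrs V adj A v = {u \<in> V. adj v u \<and> u \<in> A}"

definition bp_step :: "'a set \<Rightarrow> ('a \<Rightarrow> 'a \<Rightarrow> bool) \<Rightarrow> nat \<Rightarrow> 'a set \<Rightarrow> 'a set" where
  "bp_step V adj r A = A \<union> {v \<in> V. card (active_nbrs V adj A v) \<ge> r}"

definition rev_bp_step :: "'a set \<Rightarrow> ('a \<Rightarrow> 'a \<Rightarrow> bool) \<Rightarrow> nat \<Rightarrow> 'a set \<Rightarrow> 'a set" where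
  "rev_bp_step V adj r A = {v \<in> V. card (active_nbrs V adj A v) \<ge> r}"

definition dynamo :: "'a set \<Rightarrow> ('a set \<Rightarrow> 'a set) \<Rightarrow> 'a set \<Rightarrow> bool" where
  "dynamo V step A \<longleftrightarrow> A \<subseteq> V \<and> (\<exists>T. \<forall>t\<ge>T. (step ^^ t) A = V)"

definition monotone_dynamo :: "'a set \<Rightarrow> ('a set \<Rightarrow> 'a set) \<Rightarrow> 'a set \<Rightarrow> bool" where
  "monotone_dynamo V step A \<longleftrightarrow>
     dynamo V step A \<and> (\<forall>t. (step ^^ t) A \<subseteq> (step ^^ Suc t) A)"

text \<open>The infima below are over sets of natural numbers, hence minima whenever a dynamo exists
  (and \<open>0\<close> otherwise); see \<open>ex_dynamo_bp\<close> and \<open>ex_monotone_dynamo_rev_torus\<close>.\<close>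

definition min_dynamo_bp :: "'a set \<Rightarrow> ('a \<Rightarrow> 'a \<Rightarrow> bool) \<Rightarrow> nat \<Rightarrow> nat" where
  "min_dynamo_bp V adj r = Inf {card A |A. dynamo V (bp_step V adj r) A}"

definition min_monotone_dynamo_rev :: "'a set \<Rightarrow> ('a \<Rightarrow> 'a \<Rightarrow> bool) \<Rightarrow> nat \<Rightarrow> nat" where
  "min_monotone_dynamo_rev V adj r = Inf {card A |A. monotone_dynamo V (rev_bp_step V adj r) A}"

definition torus_verts :: "nat \<Rightarrow> nat \<Rightarrow> (nat \<Rightarrow> nat) set" where
  "torus_verts d n = {1..d} \<rightarrow>\<^sub>E {1..n}"

definition torus_adj :: "nat \<Rightarrow> nat \<Rightarrow> (nat \<Rightarrow> nat) \<Rightarrow> (nat \<Rightarrow> nat) \<Rightarrow> bool" where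
  "torus_adj d n x x' \<longleftrightarrow>
     (\<exists>j\<in>{1..d}. x j \<noteq> x' j \<and> (\<forall>i\<in>{1..d} - {j}. x i = x' i) \<and>
        ([int (x j) - int (x' j) = 1] (mod int n) \<or> [int (x j) - int (x' j) = - 1] (mod int n)))"

lemma ex_dynamo_bp: "dynamo V (bp_step V adj r) V"
proof -
  have "bp_step V adj r V = V"
    by (auto simp: bp_step_def)
  then have "(bp_step V adj r ^^ t) V = V" for t
    by (induction t) auto
  then show ?thesis
    by (auto simp: dynamo_def)
qed

lemma ex_monotone_dynamo_rev_torus:
  assumes "r \<le> d" "n \<ge> 2"
  shows "monotone_dynamo (torus_verts d n)
           (rev_bp_step (torus_verts d n) (torus_adj d n) r) (torus_verts d n)"
proof -
  let ?V = "torus_verts d n"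
  let ?s = "rev_bp_step ?V (torus_adj d n) r"
  have fin: "finite ?V"
    by (auto simp: torus_verts_def intro!: finite_PiE)
  have "r \<le> card (active_nbrs ?V (torus_adj d n) ?V v)" if v: "v \<in> ?V" for v
  proof -
    define g where "g j = (if v j = n then 1 else v j + 1)" for j
    define f where "f j = v(j := g j)" for j
    have g: "g j \<noteq> v j" for j
      using assms by (auto simp: g_def)
    have "inj_on f {1..d}"
    proof (rule inj_onI)
      fix i j assume "f i = f j"
      then have "f i i = f j i" by simp
      then show "i = j" using g[of i] by (auto simp: f_def split: if_splits)
    qed
    moreover have "f ` {1..d} \<subseteq> active_nbrs ?V (torus_adj d n) ?V v"
    proof (rule image_subsetI)
      fix j assume j: "j \<in> {1..d}"
      have vj: "v j \<in> {1..n}" using v j by (auto simp: torus_verts_def)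
      have "g j \<in> {1..n}" using vj assms by (auto simp: g_def)
      then have "f j \<in> ?V"
        using v j by (auto simp: torus_verts_def f_def PiE_iff extensional_def)
      moreover have "[int (v j) - int (g j) = - 1] (mod int n)"
        by (auto simp: g_def cong_iff_dvd_diff)
      then have "torus_adj d n v (f j)"
        unfolding torus_adj_def using j g[of j]
        by (intro bexI[of _ j]) (auto simp: f_def)
      ultimately show "f j \<in> active_nbrs ?V (torus_adj d n) ?V v"
        by (auto simp: active_nbrs_def)
    qed
    moreover have "finite (active_nbrs ?V (torus_adj d n) ?V v)"
      using fin by (auto simp: active_nbrs_def)
    ultimately have "card {1..d} \<le> card (active_nbrs ?V (torus_adj d n) ?V v)"
      using card_inj_on_le by blast
    then show ?thesis using assms by simp
  qed
  then have "?s ?V = ?V"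
    by (auto simp: rev_bp_step_def)
  then have "(?s ^^ t) ?V = ?V" for t
    by (induction t) auto
  then show ?thesis
    by (auto simp: monotone_dynamo_def dynamo_def simp del: funpow.simps)
qed

end

theory Submission
  imports Defs
begin

text \<open>
  Put \<open>k = r - 1\<close>. Call a vertex small if fewer than \<open>k\<close> of its coordinates lie outside
  \<open>{n - 1, n}\<close>; there are \<open>O(n\<^sup>k\<^sup>-\<^sup>1)\<close> of these, and all of them are activated.
  In addition, for each \<open>k\<close>-set \<open>S\<close> of coordinates, take the \<open>k\<close>-dimensional subtorus on which
  the coordinates outside \<open>S\<close> equal \<open>n\<close>, and activate its vertices \<open>x\<close> for which a linear form
  \<open>s + (\<Sum>i\<in>S. w i * x i)\<close> has its residue modulo \<open>r\<close> in a set \<open>K\<close>. Averaging over the shift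
  \<open>s\<close> makes the density of this set at most \<open>card K / r\<close>.

  Order the vertices by \<open>\<Sum>i. x i mod n\<close>. A vertex with more than \<open>k\<close> coordinates different from
  \<open>n\<close> has at least \<open>r\<close> smaller neighbours. A vertex of one of the subtori has \<open>k\<close> smaller
  neighbours, and it needs a single active larger one: this exists if every residue outside
  \<open>K\<close> is moved into \<open>K\<close> by adding some weight. For bootstrap percolation take \<open>K = {0}\<close> and the
  weights \<open>-1, \<dots>, -k\<close>. For the reversible process take \<open>K = {0, 1}\<close> and the weights
  \<open>-2, -4, \<dots>\<close> down to \<open>-k\<close> or \<open>-(k - 1)\<close>, together with \<open>\<lceil>k / 2\<rceil>\<close> weights \<open>0\<close>: the zero
  weights, for even \<open>k\<close> aided by \<open>-k\<close>, give each active vertex enough active neighbours to survive the first round, after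
  which the process is monotone and coincides with bootstrap percolation.
\<close>

section \<open>Dynamos on general graphs\<close>

lemma card_active_nbrs_mono:
  assumes "finite V" "A \<subseteq> B"
  shows "card (active_nbrs V adj A v) \<le> card (active_nbrs V adj B v)"
  using assms by (intro card_mono) (auto simp: active_nbrs_def)

text \<open>By induction on \<open>t\<close>, every vertex of rank below \<open>t\<close> is active
  after \<open>t\<close> rounds; since \<open>V\<close> is finite, the ranks are bounded.\<close>

lemma dynamo_bp_if_rank:
  fixes \<rho> :: "'a \<Rightarrow> nat"
  assumes "finite V" "A \<subseteq> V"
    and rank: "\<And>v. v \<in> V - A \<Longrightarrow> r \<le> card (active_nbrs V adj (A \<union> {u \<in> V. \<rho> u < \<rho> v}) v)"
  shows "dynamo V (bp_step V adj r) A"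
proof -
  let ?s = "bp_step V adj r"
  have sub: "A \<subseteq> (?s ^^ t) A \<and> (?s ^^ t) A \<subseteq> V" for t
    using assms(2) by (induction t) (auto simp: bp_step_def)
  have reach: "\<forall>v\<in>V. \<rho> v < t \<longrightarrow> v \<in> (?s ^^ t) A" for t
  proof (induction t)
    case (Suc t)
    show ?case
    proof (intro ballI impI)
      fix v assume v: "v \<in> V" "\<rho> v < Suc t"
      show "v \<in> (?s ^^ Suc t) A"
      proof (cases "v \<in> A")
        case True
        then show ?thesis using sub by blast
      next
        case False
        have "A \<union> {u \<in> V. \<rho> u < \<rho> v} \<subseteq> (?s ^^ t) A"
          using sub[of t] Suc v by auto
        then have "r \<le> card (active_nbrs V adj ((?s ^^ t) A) v)"
          using rank[of v] False v(1) card_active_nbrs_mono[OF \<open>finite V\<close>, of _ "(?s ^^ t) A" adj v]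
          by (meson DiffI le_trans)
        then show ?thesis using v by (simp add: bp_step_def)
      qed
    qed
  qed simp
  obtain T where T: "\<And>v. v \<in> V \<Longrightarrow> \<rho> v < T"
    using finite_nat_set_iff_bounded[of "\<rho> ` V"] \<open>finite V\<close> by auto
  have "(?s ^^ t) A = V" if "t \<ge> T" for t
    using sub[of t] reach[of t] T that by (meson less_le_trans subsetI subset_antisym)
  then show ?thesis
    using \<open>A \<subseteq> V\<close> by (auto simp: dynamo_def)
qed

text \<open>The step is monotone in the configuration, so the orbit of \<open>B\<close> stays
  between that of \<open>A\<close> and \<open>V\<close>.\<close>

lemma dynamo_bp_mono:
  assumes "finite V" "dynamo V (bp_step V adj r) A" "A \<subseteq> B" "B \<subseteq> V"
  shows "dynamo V (bp_step V adj r) B"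
proof -
  let ?s = "bp_step V adj r"
  have "(?s ^^ t) A \<subseteq> (?s ^^ t) B \<and> (?s ^^ t) B \<subseteq> V" for t
  proof (induction t)
    case (Suc t)
    have "?s X \<subseteq> ?s Y" if "X \<subseteq> Y" for X Y
      using card_active_nbrs_mono[OF \<open>finite V\<close> that, of adj] that
      by (auto simp: bp_step_def intro: order_trans)
    moreover have "?s X \<subseteq> V" if "X \<subseteq> V" for X
      using that by (auto simp: bp_step_def)
    ultimately show ?case
      using Suc by simp
  qed (use assms in auto)
  then show ?thesis
    using assms(2,4) unfolding dynamo_def by (metis subset_antisym)
qed

text \<open>The two steps agree on any set contained in its image under the reversible one.
  Monotonicity of that step carries the inclusion from the first round to all later ones.\<close>

lemma monotone_dynamo_rev_if_dynamo_bp: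
  assumes "finite V" "dynamo V (bp_step V adj r) A" "A \<subseteq> rev_bp_step V adj r A"
  shows "monotone_dynamo V (rev_bp_step V adj r) A"
proof -
  let ?b = "bp_step V adj r" and ?s = "rev_bp_step V adj r"
  have mono: "?s X \<subseteq> ?s Y" if "X \<subseteq> Y" for X Y
    using card_active_nbrs_mono[OF \<open>finite V\<close> that, of adj]
    by (auto simp: rev_bp_step_def intro: order_trans)
  have incr: "(?s ^^ t) A \<subseteq> ?s ((?s ^^ t) A)" for t
    by (induction t) (use assms(3) mono in auto)
  have "(?s ^^ t) A = (?b ^^ t) A" for t
  proof (induction t)
    case (Suc t)
    have "?s X = ?b X" if "X \<subseteq> ?s X" for X
      using that by (auto simp: bp_step_def rev_bp_step_def)
    then show ?case
      using incr[of t] Suc by simp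
  qed simp
  then show ?thesis
    using assms(2) incr by (simp add: monotone_dynamo_def dynamo_def)
qed

section \<open>Moves in the torus\<close>

definition cyc_succ :: "nat \<Rightarrow> nat \<Rightarrow> nat" where
  "cyc_succ n v = (if v = n then 1 else v + 1)"

definition cyc_pred :: "nat \<Rightarrow> nat \<Rightarrow> nat" where
  "cyc_pred n v = (if v = 1 then n else v - 1)"

lemma finite_torus_verts [simp]: "finite (torus_verts d n)"
  by (auto simp: torus_verts_def intro!: finite_PiE)

lemma torus_verts_fun_upd:
  assumes "x \<in> torus_verts d n" "i \<in> {1..d}" "y \<in> {1..n}"
  shows "x(i := y) \<in> torus_verts d n"
  using assms by (auto simp: torus_verts_def PiE_iff extensional_def)

lemma torus_verts_range:
  assumes "x \<in> torus_verts d n" "i \<in> {1..d}"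
  shows "1 \<le> x i" "x i \<le> n"
  using assms by (auto simp: torus_verts_def PiE_iff)

lemma move_in_torus:
  assumes "x \<in> torus_verts d n" "i \<in> {1..d}"
  shows "x(i := cyc_succ n (x i)) \<in> torus_verts d n" "x(i := cyc_pred n (x i)) \<in> torus_verts d n"
  using torus_verts_range[OF assms] assms
  by (auto intro!: torus_verts_fun_upd simp: cyc_succ_def cyc_pred_def)

lemma torus_adj_move:
  assumes "x \<in> torus_verts d n" "i \<in> {1..d}" "n \<ge> 2"
  shows "torus_adj d n x (x(i := cyc_succ n (x i)))" "torus_adj d n x (x(i := cyc_pred n (x i)))"
  unfolding torus_adj_def using torus_verts_range[OF assms(1,2)] assms
  by (auto intro!: bexI[of _ i] simp: cyc_succ_def cyc_pred_def cong_iff_dvd_diff of_nat_diff)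

text \<open>For \<open>n \<ge> 3\<close> the upward and the downward move in one direction have
  different targets, so no neighbour is counted twice.\<close>

lemma card_active_nbrs_ge:
  assumes "n \<ge> 3" and x: "x \<in> torus_verts d n" and "U \<subseteq> {1..d}" "D \<subseteq> {1..d}"
    and U: "\<And>i. i \<in> U \<Longrightarrow> x(i := cyc_succ n (x i)) \<in> A"
    and D: "\<And>i. i \<in> D \<Longrightarrow> x(i := cyc_pred n (x i)) \<in> A"
  shows "card U + card D \<le> card (active_nbrs (torus_verts d n) (torus_adj d n) A x)"
proof -
  let ?f = "\<lambda>i. x(i := cyc_succ n (x i))" and ?g = "\<lambda>i. x(i := cyc_pred n (x i))"
  have succ: "cyc_succ n (x i) \<noteq> x i" for i
    using assms(1) by (auto simp: cyc_succ_def)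
  have pred: "cyc_pred n (x i) \<noteq> x i" "cyc_succ n (x i) \<noteq> cyc_pred n (x i)" if "i \<in> {1..d}" for i
    using assms(1) torus_verts_range[OF x that] by (auto simp: cyc_pred_def cyc_succ_def split: if_splits)
  have "inj_on ?f U"
    by (rule inj_onI) (metis fun_upd_apply succ)
  moreover have "inj_on ?g D"
    by (rule inj_onI) (metis fun_upd_apply pred(1) assms(4) subsetD)
  moreover have "?f ` U \<inter> ?g ` D = {}"
  proof -
    have False if "i \<in> U" "j \<in> D" "?f i = ?g j" for i j
    proof -
      have "?f i i = ?g j i" using that(3) by simp
      then show False
        using succ[of i] pred(2)[of i] that(1) assms(3) by (auto split: if_splits)
    qed
    then show ?thesis by blast
  qed
  moreover have "finite U" "finite D"
    using assms(3,4) finite_subset by auto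
  ultimately have "card U + card D = card (?f ` U \<union> ?g ` D)"
    by (simp add: card_Un_disjoint card_image)
  also have "\<dots> \<le> card (active_nbrs (torus_verts d n) (torus_adj d n) A x)"
    using assms(1,3,4) U D move_in_torus[OF x] torus_adj_move[OF x]
    by (intro card_mono) (auto simp: active_nbrs_def)
  finally show ?thesis .
qed

section \<open>The seed\<close>

text \<open>The value \<open>n\<close> represents the residue 0, so this is the support of
  \<open>x\<close> modulo \<open>n\<close>.\<close>

definition off_n :: "nat \<Rightarrow> nat \<Rightarrow> (nat \<Rightarrow> nat) \<Rightarrow> nat set" where
  "off_n d n x = {i \<in> {1..d}. x i \<noteq> n}"

definition interior :: "nat \<Rightarrow> nat \<Rightarrow> (nat \<Rightarrow> nat) \<Rightarrow> nat set" where
  "interior d n x = {i \<in> {1..d}. x i + 1 < n}"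

definition small_verts :: "nat \<Rightarrow> nat \<Rightarrow> nat \<Rightarrow> (nat \<Rightarrow> nat) set" where
  "small_verts d n k = {x \<in> torus_verts d n. card (interior d n x) < k}"

definition linear_form :: "(nat \<Rightarrow> int) \<Rightarrow> nat set \<Rightarrow> (nat \<Rightarrow> nat) \<Rightarrow> int" where
  "linear_form w S x = (\<Sum>i\<in>S. w i * int (x i))"

text \<open>Asking for equality with \<open>S\<close> loses nothing in the seed: a vertex whose
  support is a proper subset of a \<open>k\<close>-set is small. Weights and shift depend on
  \<open>S\<close>, as both are chosen for each subtorus separately.\<close>

definition subtorus_verts ::
    "nat \<Rightarrow> nat \<Rightarrow> (nat set \<Rightarrow> nat \<Rightarrow> int) \<Rightarrow> (nat set \<Rightarrow> int) \<Rightarrow> int set \<Rightarrow> nat set \<Rightarrow> (nat \<Rightarrow> nat) set" where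
  "subtorus_verts d n w s Q S =
     {x \<in> torus_verts d n. off_n d n x = S \<and> s S + linear_form (w S) S x \<in> Q}"

definition seed ::
    "nat \<Rightarrow> nat \<Rightarrow> nat \<Rightarrow> (nat set \<Rightarrow> nat \<Rightarrow> int) \<Rightarrow> (nat set \<Rightarrow> int) \<Rightarrow> int set \<Rightarrow> (nat \<Rightarrow> nat) set" where
  "seed d n k w s Q =
     small_verts d n k \<union> (\<Union>S\<in>{S. S \<subseteq> {1..d} \<and> card S = k}. subtorus_verts d n w s Q S)"

lemma seed_subset: "seed d n k w s Q \<subseteq> torus_verts d n"
  by (auto simp: seed_def small_verts_def subtorus_verts_def)

lemma finite_off_n [simp]: "finite (off_n d n x)"
  by (simp add: off_n_def)

lemma finite_interior [simp]: "finite (interior d n x)"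
  by (simp add: interior_def)

lemma interior_subset_off_n: "interior d n x \<subseteq> off_n d n x"
  by (auto simp: interior_def off_n_def)

lemma linear_form_fun_upd:
  assumes "finite S" "i \<in> S"
  shows "linear_form w S (x(i := y)) = linear_form w S x + w i * (int y - int (x i))"
proof -
  have "(\<Sum>j\<in>S - {i}. w j * int ((x(i := y)) j)) = (\<Sum>j\<in>S - {i}. w j * int (x j))"
    by (rule sum.cong) auto
  then show ?thesis
    using assms by (simp add: linear_form_def sum.remove[of S i] algebra_simps)
qed

lemma small_verts_mono:
  assumes "x \<in> small_verts d n k" "y \<in> torus_verts d n" "interior d n y \<subseteq> interior d n x"
  shows "y \<in> small_verts d n k"
  using assms card_mono[OF finite_interior assms(3)] by (auto simp: small_verts_def)

lemma interior_eq_off_n: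
  assumes "x \<in> torus_verts d n" "x \<notin> small_verts d n k" "card (off_n d n x) = k"
  shows "interior d n x = off_n d n x"
  using assms interior_subset_off_n[of d n x]
  by (intro card_seteq) (auto simp: small_verts_def)

text \<open>Here the second boundary layer \<open>n - 1\<close> is used: without it, an upward move could leave
  the subtorus.\<close>

lemma up_move_in_seed:
  assumes "n \<ge> 3" and x: "x \<in> torus_verts d n" "x \<notin> small_verts d n k" and S: "off_n d n x = S" "card S = k"
    and i: "i \<in> S" and Q: "s S + linear_form (w S) S x + w S i \<in> Q"
  shows "x(i := cyc_succ n (x i)) \<in> seed d n k w s Q"
proof -
  have i': "i \<in> interior d n x" "i \<in> {1..d}" and S': "S \<subseteq> {1..d}" "finite S"
    using interior_eq_off_n[OF x] S i by (auto simp: off_n_def)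
  have up: "cyc_succ n (x i) = x i + 1" "x i + 1 < n"
    using i' by (auto simp: cyc_succ_def interior_def)
  have "off_n d n (x(i := cyc_succ n (x i))) = S"
    using up i S(1) by (auto simp: off_n_def)
  moreover have "s S + linear_form (w S) S (x(i := cyc_succ n (x i))) \<in> Q"
    using Q S' i up by (simp add: linear_form_fun_upd algebra_simps)
  ultimately show ?thesis
    using move_in_torus(1)[OF x(1) i'(2)] S' S(2) by (auto simp: seed_def subtorus_verts_def)
qed

text \<open>Either the move stays in the subtorus and subtracts \<open>w S i\<close> from the form,
  or it wraps from 1 to \<open>n\<close>; then fewer than \<open>k\<close> coordinates remain off
  \<open>n\<close> and the target is small.\<close>

lemma down_move_in_seed:
  assumes "n \<ge> 3" and x: "x \<in> torus_verts d n" and S: "off_n d n x = S" "card S = k"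
    and i: "i \<in> S" and Q: "s S + linear_form (w S) S x - w S i \<in> Q"
  shows "x(i := cyc_pred n (x i)) \<in> seed d n k w s Q"
proof -
  have i': "i \<in> {1..d}" "x i \<noteq> n" and S': "S \<subseteq> {1..d}" "finite S"
    using S i by (auto simp: off_n_def)
  let ?y = "x(i := cyc_pred n (x i))"
  have y: "?y \<in> torus_verts d n"
    using move_in_torus x i' by blast
  show ?thesis
  proof (cases "x i = 1")
    case True
    have "interior d n ?y \<subseteq> S - {i}"
      using True S(1) interior_subset_off_n[of d n x] by (auto simp: interior_def cyc_pred_def)
    then have "card (interior d n ?y) < k"
      using i S' S(2) by (metis card_Diff1_less card_mono finite_Diff le_less_trans)
    then show ?thesis using y by (simp add: seed_def small_verts_def)
  next
    case False
    then have dn: "cyc_pred n (x i) = x i - 1" "x i \<ge> 1" "x i - 1 \<noteq> n"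
      using torus_verts_range[OF x i'(1)] by (auto simp: cyc_pred_def)
    have "off_n d n ?y = S"
      using dn i S(1) by (auto simp: off_n_def)
    moreover have "s S + linear_form (w S) S ?y \<in> Q"
      using Q S' i dn by (simp add: linear_form_fun_upd algebra_simps of_nat_diff)
    ultimately show ?thesis
      using y S' S(2) by (auto simp: seed_def subtorus_verts_def)
  qed
qed

text \<open>Modulo \<open>n\<close> the value \<open>n\<close> counts as 0, so the wrap from 1 to
  \<open>n\<close> is a decrease too.\<close>

lemma sum_mod_down_move:
  assumes "n \<ge> 3" "x \<in> torus_verts d n" "i \<in> off_n d n x"
  shows "(\<Sum>j\<in>{1..d}. (x(i := cyc_pred n (x i))) j mod n) < (\<Sum>j\<in>{1..d}. x j mod n)"
proof (rule sum_strict_mono_ex1)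
  have i: "i \<in> {1..d}" "x i \<noteq> n" using assms(3) by (auto simp: off_n_def)
  then have "cyc_pred n (x i) mod n < x i mod n"
    using torus_verts_range[OF assms(2) i(1)] assms(1) by (auto simp: cyc_pred_def)
  then show "\<forall>j\<in>{1..d}. (x(i := cyc_pred n (x i))) j mod n \<le> x j mod n"
    and "\<exists>j\<in>{1..d}. (x(i := cyc_pred n (x i))) j mod n < x j mod n"
    using i by auto
qed simp

text \<open>Every coordinate off \<open>n\<close> yields a neighbour of smaller rank. An inactive
  vertex has at least \<open>k\<close> such coordinates; if exactly \<open>k\<close>, the assumption
  on \<open>Q\<close> supplies the missing neighbour.\<close>

lemma dynamo_bp_seed:
  assumes "n \<ge> 3"
    and Q: "\<And>S c. S \<subseteq> {1..d} \<Longrightarrow> card S = k \<Longrightarrow> c \<notin> Q \<Longrightarrow> \<exists>i\<in>S. c + w S i \<in> Q"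
  shows "dynamo (torus_verts d n) (bp_step (torus_verts d n) (torus_adj d n) (k + 1)) (seed d n k w s Q)"
proof (rule dynamo_bp_if_rank[where \<rho> = "\<lambda>x. \<Sum>j\<in>{1..d}. x j mod n"])
  let ?\<rho> = "\<lambda>x. \<Sum>j\<in>{1..d}. x j mod n"
  fix x assume x: "x \<in> torus_verts d n - seed d n k w s Q"
  let ?I = "off_n d n x"
  let ?A = "seed d n k w s Q \<union> {u \<in> torus_verts d n. ?\<rho> u < ?\<rho> x}"
  have I: "?I \<subseteq> {1..d}" by (auto simp: off_n_def)
  have small: "x \<notin> small_verts d n k" using x by (simp add: seed_def)
  have down: "x(i := cyc_pred n (x i)) \<in> ?A" if "i \<in> ?I" for i
    using sum_mod_down_move[OF assms(1) _ that] move_in_torus(2)[of x d n i] x that I by auto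
  have "k \<le> card ?I"
    using small x card_mono[OF finite_off_n interior_subset_off_n, of d n x]
    by (auto simp: small_verts_def)
  then consider "k + 1 \<le> card ?I" | "card ?I = k" by linarith
  then show "k + 1 \<le> card (active_nbrs (torus_verts d n) (torus_adj d n) ?A x)"
  proof cases
    case 1
    then show ?thesis
      using card_active_nbrs_ge[OF assms(1), of x d "{}" ?I ?A] x I down by auto
  next
    case 2
    have "s ?I + linear_form (w ?I) ?I x \<notin> Q"
      using x 2 I by (auto simp: seed_def subtorus_verts_def)
    then obtain i where i: "i \<in> ?I" "s ?I + linear_form (w ?I) ?I x + w ?I i \<in> Q"
      using Q[OF I 2] by blast
    \<comment> \<open>This neighbour has larger rank than \<open>x\<close>, so it has to lie in the
      seed itself.\<close>
    have "x(i := cyc_succ n (x i)) \<in> ?A"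
      using up_move_in_seed[where S = ?I and w = w and s = s and Q = Q, OF assms(1) _ small refl 2 i] x
      by auto
    then show ?thesis
      using card_active_nbrs_ge[OF assms(1), of x d "{i}" ?I ?A] x I down i(1) 2 by auto
  qed
qed (simp_all add: seed_subset)

text \<open>A small vertex has a small neighbour in each of the \<open>d \<ge> k + 1\<close>
  directions. For the other vertices of the seed, the assumption counts the moves along the subtorus
  that keep the residue in \<open>Q\<close>.\<close>

lemma seed_subset_rev_bp_step:
  assumes "n \<ge> 3" "k + 1 \<le> d"
    and Q: "\<And>S c. S \<subseteq> {1..d} \<Longrightarrow> card S = k \<Longrightarrow> c \<in> Q \<Longrightarrow>
        k + 1 \<le> card {i \<in> S. c + w S i \<in> Q} + card {i \<in> S. c - w S i \<in> Q}"
  shows "seed d n k w s Q \<subseteq> rev_bp_step (torus_verts d n) (torus_adj d n) (k + 1) (seed d n k w s Q)"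
proof
  fix x assume xs: "x \<in> seed d n k w s Q"
  then have x: "x \<in> torus_verts d n" using seed_subset by blast
  let ?I = "off_n d n x"
  have I: "?I \<subseteq> {1..d}" by (auto simp: off_n_def)
  have "k + 1 \<le> card (active_nbrs (torus_verts d n) (torus_adj d n) (seed d n k w s Q) x)"
  proof (cases "x \<in> small_verts d n k")
    case True
    have "x(i := cyc_succ n (x i)) \<in> seed d n k w s Q" if "i \<in> ?I" for i
    proof -
      have i: "i \<in> {1..d}" "x i \<noteq> n" using that by (auto simp: off_n_def)
      then have "interior d n (x(i := cyc_succ n (x i))) \<subseteq> interior d n x"
        by (auto simp: interior_def cyc_succ_def split: if_splits)
      then show ?thesis
        using small_verts_mono[OF True move_in_torus(1)[OF x i(1)]] by (simp add: seed_def)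
    qed
    \<comment> \<open>The direction matters: \<open>n\<close> has to go down to
      \<open>n - 1\<close>, since going up to 1 would create an interior coordinate. For
      \<open>n - 1\<close> it is the reverse.\<close>
    moreover have "x(i := cyc_pred n (x i)) \<in> seed d n k w s Q" if "i \<in> {1..d} - ?I" for i
    proof -
      have i: "i \<in> {1..d}" "x i = n" using that by (auto simp: off_n_def)
      then have "interior d n (x(i := cyc_pred n (x i))) \<subseteq> interior d n x"
        using assms(1) by (auto simp: interior_def cyc_pred_def split: if_splits)
      then show ?thesis
        using small_verts_mono[OF True move_in_torus(2)[OF x i(1)]] by (simp add: seed_def)
    qed
    ultimately have "card ?I + card ({1..d} - ?I)
        \<le> card (active_nbrs (torus_verts d n) (torus_adj d n) (seed d n k w s Q) x)"
      using card_active_nbrs_ge[OF assms(1) x I, of "{1..d} - ?I"] by blast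
    moreover have "card ?I + card ({1..d} - ?I) = d"
      using I card_mono[OF _ I] by (simp add: card_Diff_subset)
    ultimately show ?thesis using assms(2) by linarith
  next
    case False
    then have k: "card ?I = k" and c: "s ?I + linear_form (w ?I) ?I x \<in> Q"
      using xs by (auto simp: seed_def subtorus_verts_def)
    let ?c = "s ?I + linear_form (w ?I) ?I x"
    have "card {i \<in> ?I. ?c + w ?I i \<in> Q} + card {i \<in> ?I. ?c - w ?I i \<in> Q}
        \<le> card (active_nbrs (torus_verts d n) (torus_adj d n) (seed d n k w s Q) x)"
      using up_move_in_seed[OF assms(1) x False refl k] down_move_in_seed[OF assms(1) x refl k] I
      by (intro card_active_nbrs_ge[OF assms(1) x]) auto
    then show ?thesis using Q[OF I k c] by linarith
  qed
  then show "x \<in> rev_bp_step (torus_verts d n) (torus_adj d n) (k + 1) (seed d n k w s Q)"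
    using x by (simp add: rev_bp_step_def)
qed

section \<open>The size of the seed\<close>

lemma card_small_verts:
  assumes "n \<ge> 3"
  shows "real (card (small_verts d n k)) \<le> 4 ^ d * real n powi (int k - 1)"
proof (cases k)
  \<comment> \<open>No vertex is small here, and the bound, with exponent -1, is
    nonnegative.\<close>
  case 0
  then show ?thesis by (simp add: small_verts_def)
next
  case (Suc l)
  \<comment> \<open>Boxes indexed by the possible interiors \<open>S\<close>: at most
    \<open>2 ^ d\<close> of them, with at most \<open>2 ^ d\<close> choices for the coordinates
    outside \<open>S\<close>. This is the origin of \<open>4 ^ d\<close>.\<close>
  define P where "P S = (\<Pi>\<^sub>E i\<in>{1..d}. if i \<in> S then {1..n} else {n - 1, n})" for S
  define \<S> where "\<S> = {S. S \<subseteq> {1..d} \<and> card S \<le> l}"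
  have fin: "finite \<S>" and \<S>: "card \<S> \<le> 2 ^ d"
  proof -
    have "\<S> \<subseteq> Pow {1..d}" by (auto simp: \<S>_def)
    then show "finite \<S>" "card \<S> \<le> 2 ^ d"
      using finite_subset card_mono[of "Pow {1..d}" \<S>] by (auto simp: card_Pow)
  qed
  have P: "card (P S) \<le> n ^ l * 2 ^ d" if "S \<in> \<S>" for S
  proof -
    have S: "S \<subseteq> {1..d}" "card S \<le> l" using that by (auto simp: \<S>_def)
    have "card (P S) = (\<Prod>i\<in>{1..d}. if i \<in> S then n else 2)"
      unfolding P_def using assms by (subst card_PiE) (auto intro!: prod.cong)
    also have "\<dots> = n ^ card S * 2 ^ card ({1..d} - S)"
      using S(1) by (simp add: prod.If_cases Int_absorb1 Diff_eq)
    also have "\<dots> \<le> n ^ l * 2 ^ d"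
      using assms S card_mono[of "{1..d}" "{1..d} - S"] by (intro mult_mono power_increasing) auto
    finally show ?thesis .
  qed
  have "small_verts d n k \<subseteq> (\<Union>S\<in>\<S>. P S)"
  proof
    fix x assume x: "x \<in> small_verts d n k"
    have "x i \<in> {n - 1, n}" if "i \<in> {1..d}" "i \<notin> interior d n x" for i
      using x that torus_verts_range[of x d n i] by (auto simp: small_verts_def interior_def)
    then have "x \<in> P (interior d n x)"
      using x by (auto simp: P_def small_verts_def torus_verts_def PiE_iff)
    moreover have "interior d n x \<in> \<S>"
      using x Suc by (auto simp: \<S>_def small_verts_def interior_def)
    ultimately show "x \<in> (\<Union>S\<in>\<S>. P S)" by blast
  qed
  then have "card (small_verts d n k) \<le> card (\<Union>S\<in>\<S>. P S)"
    using fin by (intro card_mono) (auto simp: P_def intro!: finite_PiE)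
  also have "\<dots> \<le> (\<Sum>S\<in>\<S>. card (P S))"
    using fin by (rule card_UN_le)
  also have "\<dots> \<le> card \<S> * (n ^ l * 2 ^ d)"
    using P sum_bounded_above[of \<S> "\<lambda>S. card (P S)" "n ^ l * 2 ^ d"] by simp
  also have "\<dots> \<le> 2 ^ d * (n ^ l * 2 ^ d)"
    using \<S> by (rule mult_right_mono) simp
  also have "\<dots> = 4 ^ d * n ^ l"
    by (simp flip: power_mult_distrib)
  finally have "real (card (small_verts d n k)) \<le> real (4 ^ d * n ^ l)"
    by (rule of_nat_mono)
  then show ?thesis using Suc by (simp add: power_int_def)
qed

text \<open>Double counting of pairs of a shift and a point: if every shift exceeded the average, so
  would the total.\<close>

lemma exists_shift:
  fixes f :: "'a \<Rightarrow> int" and m :: nat and K :: "int set"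
  assumes "finite X" "finite K" "m > 0"
  shows "\<exists>s. m * card {x \<in> X. (s + f x) mod int m \<in> K} \<le> card K * card X"
proof (rule ccontr)
  assume "\<not> ?thesis"
  then have gt: "card K * card X < m * card {x \<in> X. (s + f x) mod int m \<in> K}" for s
    by (simp add: not_le)
  let ?M = "{0..<int m}"
  \<comment> \<open>For a fixed point, distinct shifts in \<open>?M\<close> give distinct residues,
    so at most \<open>card K\<close> of them hit \<open>K\<close>.\<close>
  have "card {s \<in> ?M. (s + c) mod int m \<in> K} \<le> card K" for c
  proof (rule card_inj_on_le[where f = "\<lambda>s. (s + c) mod int m"])
    show "inj_on (\<lambda>s. (s + c) mod int m) {s \<in> ?M. (s + c) mod int m \<in> K}"
    proof (rule inj_onI)
      fix s t assume st: "s \<in> {s \<in> ?M. (s + c) mod int m \<in> K}" "t \<in> {s \<in> ?M. (s + c) mod int m \<in> K}"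
        and "(s + c) mod int m = (t + c) mod int m"
      then have "s mod int m = t mod int m"
        using cong_add_rcancel[of s c t "int m"] by (simp add: cong_def)
      then show "s = t" using st by simp
    qed
  qed (use assms in auto)
  then have "(\<Sum>x\<in>X. card {s \<in> ?M. (s + f x) mod int m \<in> K}) \<le> card X * card K"
    using sum_bounded_above[of X "\<lambda>x. card {s \<in> ?M. (s + f x) mod int m \<in> K}" "card K"] by simp
  moreover have "(\<Sum>s\<in>?M. card {x \<in> X. (s + f x) mod int m \<in> K})
      = (\<Sum>x\<in>X. card {s \<in> ?M. (s + f x) mod int m \<in> K})"
    using assms(1) by (intro sum_multicount_gen) auto
  ultimately have "(\<Sum>s\<in>?M. m * card {x \<in> X. (s + f x) mod int m \<in> K}) \<le> m * (card X * card K)"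
    by (simp flip: sum_distrib_left)
  moreover have "(\<Sum>s\<in>?M. card K * card X) < (\<Sum>s\<in>?M. m * card {x \<in> X. (s + f x) mod int m \<in> K})"
    using gt assms(3) by (intro sum_strict_mono) auto
  ultimately show False by (simp add: mult.commute)
qed

lemma card_subtorus:
  assumes "S \<subseteq> {1..d}"
  shows "card {x \<in> torus_verts d n. off_n d n x = S} \<le> n ^ card S"
proof -
  have "{x \<in> torus_verts d n. off_n d n x = S} \<subseteq> (\<Pi>\<^sub>E i\<in>{1..d}. if i \<in> S then {1..n} else {n})"
    by (auto simp: torus_verts_def off_n_def PiE_iff extensional_def split: if_splits)
  then have "card {x \<in> torus_verts d n. off_n d n x = S}
      \<le> card (\<Pi>\<^sub>E i\<in>{1..d}. if i \<in> S then {1..n} else {n})"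
    by (intro card_mono finite_PiE) auto
  also have "\<dots> = (\<Prod>i\<in>{1..d}. if i \<in> S then n else 1)"
    by (subst card_PiE) (auto intro!: prod.cong)
  also have "\<dots> = n ^ card S"
    using assms by (simp add: prod.If_cases Int_absorb1)
  finally show ?thesis .
qed

text \<open>Averaging provides a good shift for each \<open>S\<close> independently; the sum over
  the \<open>d choose k\<close> subtori gives the main term, the small vertices the error
  term.\<close>

lemma exists_small_seed:
  fixes K :: "int set"
  assumes "n \<ge> 3" "finite K"
  shows "\<exists>s. real (card (seed d n k w s {c. c mod int (k + 1) \<in> K}))
    \<le> real (card K) / real (k + 1) * real (d choose k) * real n ^ k + 4 ^ d * real n powi (int k - 1)"
proof -
  let ?Q = "{c. c mod int (k + 1) \<in> K}"
  let ?\<S> = "{S. S \<subseteq> {1..d} \<and> card S = k}"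
  define X where "X S = {x \<in> torus_verts d n. off_n d n x = S}" for S
  have "\<forall>S. \<exists>s. (k + 1) * card {x \<in> X S. (s + linear_form (w S) S x) mod int (k + 1) \<in> K}
      \<le> card K * card (X S)"
    using assms(2) by (intro allI exists_shift) (auto simp: X_def)
  from choice[OF this] obtain s where
    s: "\<And>S. (k + 1) * card {x \<in> X S. (s S + linear_form (w S) S x) mod int (k + 1) \<in> K}
      \<le> card K * card (X S)"
    by blast
  have fin: "finite ?\<S>" by simp
  have sub: "real (card (subtorus_verts d n w s ?Q S)) \<le> real (card K) / real (k + 1) * real n ^ k"
    if "S \<in> ?\<S>" for S
  proof -
    have "subtorus_verts d n w s ?Q S
        = {x \<in> X S. (s S + linear_form (w S) S x) mod int (k + 1) \<in> K}"
      by (auto simp: subtorus_verts_def X_def)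
    then have "(k + 1) * card (subtorus_verts d n w s ?Q S) \<le> card K * card (X S)"
      using s by simp
    also have "\<dots> \<le> card K * n ^ k"
      using card_subtorus[of S d n] that by (intro mult_le_mono2) (auto simp: X_def)
    finally have "(k + 1) * card (subtorus_verts d n w s ?Q S) \<le> card K * n ^ k" .
    then have "real ((k + 1) * card (subtorus_verts d n w s ?Q S)) \<le> real (card K * n ^ k)"
      by (rule of_nat_mono)
    then show ?thesis by (simp add: field_simps)
  qed
  have "card (seed d n k w s ?Q)
      \<le> card (small_verts d n k) + card (\<Union>S\<in>?\<S>. subtorus_verts d n w s ?Q S)"
    unfolding seed_def by (rule card_Un_le)
  also have "\<dots> \<le> card (small_verts d n k) + (\<Sum>S\<in>?\<S>. card (subtorus_verts d n w s ?Q S))"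
    using card_UN_le[OF fin] by simp
  finally have "real (card (seed d n k w s ?Q))
      \<le> real (card (small_verts d n k) + (\<Sum>S\<in>?\<S>. card (subtorus_verts d n w s ?Q S)))"
    by (rule of_nat_mono)
  also have "\<dots> = real (card (small_verts d n k)) + (\<Sum>S\<in>?\<S>. real (card (subtorus_verts d n w s ?Q S)))"
    by (simp only: of_nat_add of_nat_sum)
  also have "\<dots> \<le> 4 ^ d * real n powi (int k - 1)
      + real (card ?\<S>) * (real (card K) / real (k + 1) * real n ^ k)"
    by (intro add_mono card_small_verts[OF assms(1)] sum_bounded_above sub)
  also have "card ?\<S> = d choose k"
    using n_subsets[of "{1..d}" k] by simp
  finally show ?thesis by (intro exI[of _ s]) (simp add: mult_ac)
qed

section \<open>Choice of the weights\<close>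

text \<open>Any bijection serves; fixing one numbers the directions in \<open>S\<close>, so that
  weights can be given by index.\<close>

definition enum_of :: "nat set \<Rightarrow> nat \<Rightarrow> nat" where
  "enum_of S = (SOME h. bij_betw h S {1..card S})"

lemma bij_betw_enum_of:
  assumes "finite S"
  shows "bij_betw (enum_of S) S {1..card S}"
proof -
  have "\<exists>h. bij_betw h S {1..card S}"
    using assms by (intro finite_same_card_bij) auto
  then show ?thesis
    unfolding enum_of_def by (rule someI_ex)
qed

text \<open>A nonzero residue is itself the index of a direction, whose weight cancels it.\<close>

lemma percolating_weights:
  fixes c :: int
  assumes "finite S" "card S = k" "c mod int (k + 1) \<notin> {0}"
  shows "\<exists>i\<in>S. (c + (- int (enum_of S i))) mod int (k + 1) \<in> {0}"
proof -
  let ?c = "nat (c mod int (k + 1))"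
  have c: "int ?c = c mod int (k + 1)" by simp
  have "c mod int (k + 1) < int (k + 1)" by (rule pos_mod_bound) simp
  then have "?c \<in> {1..k}" using assms(3) c unfolding atLeastAtMost_iff singleton_iff by linarith
  then obtain i where "i \<in> S" "enum_of S i = ?c"
    using bij_betw_enum_of[OF assms(1)] assms(2) by (metis bij_betw_imp_surj_on imageE)
  then show ?thesis
    using c by (intro bexI[of _ i]) (auto simp: mod_diff_right_eq)
qed

definition rev_weight :: "nat \<Rightarrow> nat \<Rightarrow> int" where
  "rev_weight k j = (if 2 * j \<le> k then - 2 * int j else 0)"

text \<open>A residue \<open>b \<ge> 2\<close> is reduced to its parity by the weight with index
  \<open>b div 2\<close>.\<close>

lemma percolating_rev_weights:
  fixes c :: int
  assumes "finite S" "card S = k" "c mod int (k + 1) \<notin> {0, 1}"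
  shows "\<exists>i\<in>S. (c + rev_weight k (enum_of S i)) mod int (k + 1) \<in> {0, 1}"
proof -
  define b where "b = nat (c mod int (k + 1))"
  have c: "int b = c mod int (k + 1)" by (simp add: b_def)
  have "c mod int (k + 1) < int (k + 1)" by (rule pos_mod_bound) simp
  then have b: "2 \<le> b" "b \<le> k" using assms(3) c unfolding insert_iff by linarith+
  then have "b div 2 \<in> {1..k}" by auto
  then obtain i where i: "i \<in> S" "enum_of S i = b div 2"
    using bij_betw_enum_of[OF assms(1)] assms(2) by (metis bij_betw_imp_surj_on imageE)
  have "(c + rev_weight k (enum_of S i)) mod int (k + 1) = (int b - 2 * int (b div 2)) mod int (k + 1)"
    using b i(2) c by (simp add: rev_weight_def mod_diff_left_eq)
  also have "int b - 2 * int (b div 2) = int (b mod 2)"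
    by (simp add: zmod_int zdiv_int minus_mult_div_eq_mod)
  also have "int (b mod 2) mod int (k + 1) \<in> {0, 1}"
    using b by (cases "even b") auto
  finally show ?thesis using i(1) by (intro bexI)
qed

text \<open>Each weight \<open>0\<close> gives two neighbours. For even \<open>k\<close> this is one too few, and the missing one
  comes from the weight \<open>-k\<close>, which is congruent to \<open>1\<close> and hence exchanges the residues
  \<open>0\<close> and \<open>1\<close>.\<close>

lemma self_supporting_rev_weights:
  fixes c :: int
  assumes "finite S" "card S = k" "k \<ge> 1" "c mod int (k + 1) \<in> {0, 1}"
  shows "k + 1 \<le> card {i \<in> S. (c + rev_weight k (enum_of S i)) mod int (k + 1) \<in> {0, 1}}
    + card {i \<in> S. (c - rev_weight k (enum_of S i)) mod int (k + 1) \<in> {0, 1}}" (is "_ \<le> card ?U + card ?D")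
proof -
  have bij: "bij_betw (enum_of S) S {1..k}" using bij_betw_enum_of assms by blast
  define Z where "Z = {i \<in> S. k < 2 * enum_of S i}"
  have "bij_betw (enum_of S) Z {j \<in> {1..k}. k < 2 * j}"
    using bij unfolding Z_def bij_betw_def by (auto intro: inj_on_subset)
  then have "card Z = card {j \<in> {1..k}. k < 2 * j}" by (rule bij_betw_same_card)
  also have "{j \<in> {1..k}. k < 2 * j} = {k div 2 + 1..k}" by auto
  finally have Z: "card Z = k - k div 2" by simp
  have fin: "finite Z" "finite ?U" "finite ?D" using assms(1) by (auto simp: Z_def)
  have sub: "Z \<subseteq> ?U" "Z \<subseteq> ?D" using assms(4) by (auto simp: Z_def rev_weight_def)
  show ?thesis
  proof (cases "odd k")
    case True
    then have "k + 1 = card Z + card Z" using Z by (auto elim!: oddE)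
    then show ?thesis using card_mono[OF fin(2) sub(1)] card_mono[OF fin(3) sub(2)] by linarith
  next
    case False
    then have "k div 2 \<in> {1..k}" using assms(3) by (auto elim!: evenE)
    then obtain i where i: "i \<in> S" "enum_of S i = k div 2"
      using bij by (metis bij_betw_imp_surj_on imageE)
    \<comment> \<open>The weight \<open>-k\<close> is written so that its residue 1 modulo
      \<open>k + 1\<close> is visible.\<close>
    then have iZ: "i \<notin> Z" and w: "rev_weight k (enum_of S i) = 1 - int (k + 1)"
      using False by (auto simp: Z_def rev_weight_def elim!: evenE)
    have k: "k + 1 = card Z + card (insert i Z)"
      using Z False fin(1) iZ by (auto elim!: evenE)
    show ?thesis
    proof (cases "c mod int (k + 1) = 0")
      case True
      have "(c + rev_weight k (enum_of S i)) mod int (k + 1) = (c mod int (k + 1) + 1) mod int (k + 1)"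
        unfolding w by (metis add.commute add_diff_eq mod_add_left_eq mod_diff_right_eq mod_self diff_zero)
      then have "insert i Z \<subseteq> ?U" using sub i(1) True assms(3) by auto
      then show ?thesis
        using card_mono[OF fin(2), of "insert i Z"] card_mono[OF fin(3) sub(2)] k by linarith
    next
      case False
      then have c1: "c mod int (k + 1) = 1" using assms(4) by blast
      have "(c - rev_weight k (enum_of S i)) mod int (k + 1) = (c mod int (k + 1) - 1) mod int (k + 1)"
        unfolding w mod_diff_left_eq by (metis add_diff_eq add.commute diff_diff_eq2 mod_add_self2)
      then have "insert i Z \<subseteq> ?D" using sub i(1) c1 by auto
      then show ?thesis
        using card_mono[OF fin(3), of "insert i Z"] card_mono[OF fin(2) sub(1)] k by linarith
    qed
  qed
qed

section \<open>The two bounds\<close>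

lemma min_dynamo_bp_le:
  assumes "dynamo V (bp_step V adj r) A"
  shows "min_dynamo_bp V adj r \<le> card A"
  unfolding min_dynamo_bp_def using assms by (intro cInf_lower) auto

lemma min_monotone_dynamo_rev_le:
  assumes "monotone_dynamo V (rev_bp_step V adj r) A"
  shows "min_monotone_dynamo_rev V adj r \<le> card A"
  unfolding min_monotone_dynamo_rev_def using assms by (intro cInf_lower) auto

lemma min_dynamo_bp_torus_le:
  assumes "n \<ge> 3"
  shows "real (min_dynamo_bp (torus_verts d n) (torus_adj d n) (k + 1))
    \<le> 1 / real (k + 1) * real (d choose k) * real n ^ k + 4 ^ d * real n powi (int k - 1)"
proof -
  let ?w = "\<lambda>S i. - int (enum_of S i)" and ?Q = "{c. c mod int (k + 1) \<in> {0}}"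
  obtain s where s: "real (card (seed d n k ?w s ?Q))
      \<le> real (card {0::int}) / real (k + 1) * real (d choose k) * real n ^ k + 4 ^ d * real n powi (int k - 1)"
    using exists_small_seed[OF assms, of "{0}" d k ?w] by blast
  have "\<exists>i\<in>S. c + ?w S i \<in> ?Q" if "S \<subseteq> {1..d}" "card S = k" "c \<notin> ?Q" for S c
    using percolating_weights[of S k c] that finite_subset by auto
  then have "dynamo (torus_verts d n) (bp_step (torus_verts d n) (torus_adj d n) (k + 1)) (seed d n k ?w s ?Q)"
    by (rule dynamo_bp_seed[OF assms])
  from min_dynamo_bp_le[OF this] s show ?thesis by simp
qed

text \<open>The two residues 0 and 1 account for the factor 2. For \<open>k = 0\<close> a subtorus
  is a single vertex, with no neighbour inside to support it, hence
  \<open>k \<ge> 1\<close>.\<close>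

lemma min_monotone_dynamo_rev_torus_le:
  assumes "n \<ge> 3" "k \<ge> 1" "k + 1 \<le> d"
  shows "real (min_monotone_dynamo_rev (torus_verts d n) (torus_adj d n) (k + 1))
    \<le> 2 / real (k + 1) * real (d choose k) * real n ^ k + 4 ^ d * real n powi (int k - 1)"
proof -
  let ?w = "\<lambda>S i. rev_weight k (enum_of S i)" and ?Q = "{c. c mod int (k + 1) \<in> {0, 1}}"
  let ?V = "torus_verts d n"
  obtain s where s: "real (card (seed d n k ?w s ?Q))
      \<le> real (card {0::int, 1}) / real (k + 1) * real (d choose k) * real n ^ k + 4 ^ d * real n powi (int k - 1)"
    using exists_small_seed[OF assms(1), of "{0, 1}" d k ?w] by blast
  have "\<exists>i\<in>S. c + ?w S i \<in> ?Q" if "S \<subseteq> {1..d}" "card S = k" "c \<notin> ?Q" for S c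
    using percolating_rev_weights[of S k c] that finite_subset by auto
  then have "dynamo ?V (bp_step ?V (torus_adj d n) (k + 1)) (seed d n k ?w s ?Q)"
    by (rule dynamo_bp_seed[OF assms(1)])
  moreover have "k + 1 \<le> card {i \<in> S. c + ?w S i \<in> ?Q} + card {i \<in> S. c - ?w S i \<in> ?Q}"
    if "S \<subseteq> {1..d}" "card S = k" "c \<in> ?Q" for S c
    using self_supporting_rev_weights[of S k c] that assms(2) finite_subset[of S] by simp
  then have "seed d n k ?w s ?Q \<subseteq> rev_bp_step ?V (torus_adj d n) (k + 1) (seed d n k ?w s ?Q)"
    by (rule seed_subset_rev_bp_step[OF assms(1,3)])
  ultimately have "monotone_dynamo ?V (rev_bp_step ?V (torus_adj d n) (k + 1)) (seed d n k ?w s ?Q)"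
    by (intro monotone_dynamo_rev_if_dynamo_bp) simp_all
  from min_monotone_dynamo_rev_le[OF this] s show ?thesis by simp
qed

text \<open>One active vertex percolates for threshold 1, and an adjacent second one lets the two
  keep each other active.\<close>

lemma min_monotone_dynamo_rev_torus_1_le:
  assumes "n \<ge> 3" "d \<ge> 1"
  shows "min_monotone_dynamo_rev (torus_verts d n) (torus_adj d n) 1 \<le> 2"
proof -
  let ?V = "torus_verts d n" and ?adj = "torus_adj d n"
  define x where "x = (\<lambda>i\<in>{1..d}. n)"
  define y where "y = x(1 := cyc_pred n (x 1))"
  have one: "1 \<in> {1..d}" using assms by simp
  have x: "x \<in> ?V" using assms by (auto simp: x_def torus_verts_def)
  have y: "y \<in> ?V" using move_in_torus[OF x one] by (simp add: y_def)
  have return: "y(1 := cyc_succ n (y 1)) = x"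
    using assms by (auto simp: y_def x_def cyc_pred_def cyc_succ_def)
  \<comment> \<open>For \<open>k = 0\<close> the only \<open>S\<close> is empty, so with
    \<open>UNIV\<close> as residue condition the seed reduces to the corner
    \<open>x\<close>.\<close>
  have "dynamo ?V (bp_step ?V ?adj (0 + 1)) (seed d n 0 (\<lambda>_ _. 0) (\<lambda>_. 0) UNIV)"
    by (rule dynamo_bp_seed[OF assms(1)]) simp
  moreover have "seed d n 0 (\<lambda>_ _. 0) (\<lambda>_. 0) UNIV \<subseteq> {x}"
  proof
    fix z assume "z \<in> seed d n 0 (\<lambda>_ _. 0) (\<lambda>_. 0) UNIV"
    then have z: "z \<in> ?V" "off_n d n z = {}"
      by (auto simp: seed_def small_verts_def subtorus_verts_def dest: finite_subset)
    then have "z = x"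
      by (intro ext) (auto simp: x_def torus_verts_def off_n_def PiE_iff extensional_def)
    then show "z \<in> {x}" by simp
  qed
  then have "seed d n 0 (\<lambda>_ _. 0) (\<lambda>_. 0) UNIV \<subseteq> {x, y}"
    by blast
  ultimately have "dynamo ?V (bp_step ?V ?adj (0 + 1)) {x, y}"
    by (rule dynamo_bp_mono[OF finite_torus_verts]) (use x y in simp)
  then have "dynamo ?V (bp_step ?V ?adj 1) {x, y}"
    by simp
  moreover have "1 \<le> card (active_nbrs ?V ?adj {x, y} x)"
    using card_active_nbrs_ge[OF assms(1) x, of "{}" "{1}" "{x, y}"] one by (simp add: y_def)
  moreover have "1 \<le> card (active_nbrs ?V ?adj {x, y} y)"
    using card_active_nbrs_ge[OF assms(1) y, of "{1}" "{}" "{x, y}"] one return by simp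
  ultimately have "monotone_dynamo ?V (rev_bp_step ?V ?adj 1) {x, y}"
    using x y by (intro monotone_dynamo_rev_if_dynamo_bp) (auto simp: rev_bp_step_def)
  from min_monotone_dynamo_rev_le[OF this] show ?thesis
    using card_insert_le_m1[of 2 "{y}" x] by simp
qed

theorem theorem4:
  fixes d r :: nat
  assumes "d \<ge> 1" and "1 \<le> r" and "r \<le> d"
  shows "\<exists>C::real. \<exists>n\<^sub>0::nat. C > 0 \<and> (\<forall>n\<ge>n\<^sub>0.
      real (min_monotone_dynamo_rev (torus_verts d n) (torus_adj d n) r)
        \<le> 2 / real r * real (d choose (r - 1)) * real n ^ (r - 1) + C * real n powi (int r - 2)
    \<and> real (min_dynamo_bp (torus_verts d n) (torus_adj d n) r)
        \<le> 1 / real r * real (d choose (r - 1)) * real n ^ (r - 1) + C * real n powi (int r - 2))"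
proof -
  obtain k where k: "r = k + 1" using assms(2) by (metis add.commute le_Suc_ex)
  have exponent: "int r - 2 = int k - 1" using k by simp
  have "real (min_monotone_dynamo_rev (torus_verts d n) (torus_adj d n) r)
      \<le> 2 / real r * real (d choose (r - 1)) * real n ^ (r - 1) + 4 ^ d * real n powi (int r - 2)"
    if n: "n \<ge> 3" for n
  proof (cases "k = 0")
    case True
    \<comment> \<open>For \<open>r = 1\<close> the main term is exactly 2, so the error term only
      has to be nonnegative.\<close>
    have "0 \<le> 4 ^ d * real n powi (int r - 2)" by simp
    then show ?thesis
      using min_monotone_dynamo_rev_torus_1_le[OF n assms(1)] True k by (simp add: add_increasing2)
  next
    case False
    then show ?thesis
      using min_monotone_dynamo_rev_torus_le[OF n, of k d] assms(3) k unfolding exponent by simp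
  qed
  moreover have "real (min_dynamo_bp (torus_verts d n) (torus_adj d n) r)
      \<le> 1 / real r * real (d choose (r - 1)) * real n ^ (r - 1) + 4 ^ d * real n powi (int r - 2)"
    if "n \<ge> 3" for n
    using min_dynamo_bp_torus_le[OF that, of d k] unfolding exponent k by simp
  ultimately show ?thesis
    by (intro exI[of _ "4 ^ d"] exI[of _ 3]) simp
qed

end
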